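(* Let $L\in\mathrm{Lin}\,\mathbb H$ be symmetric with $\mathrm{Im}\,L$ positive semidefinite, let $P:\mathbb H_{\rm eff}^*\to\mathbb H^*$ be an embedding map with pseudo inverse $P^I$ and $Q=1-PP^I$, suppose that $L$ has a $Q$-resolvent $G$, and put $L_{\rm eff}:=P^TLP-P^TLGLP$. (i) For any $\psi_{\rm eff}\in\mathbb H_{\rm eff}^*$ with $L_{\rm eff}\psi_{\rm eff}=0$, the vector $\psi:=(P-GLP)\psi_{\rm eff}\in\mathbb H^*$ satisfies $L\psi=0$ and $\psi_{\rm eff}=P^I\psi$. (ii) For any $\psi\in\mathbb H^*$ with $L\psi=0$, the vector $\psi_{\rm eff}:=P^I\psi\in\mathbb H_{\rm eff}^*$ satisfies $L_{\rm eff}\psi_{\rm eff}=0$, and $\psi$ can be reconstructed from $\psi_{\rm eff}$ by $$\psi=(P-GLP)\psi_{\rm eff}.$$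
   Context: Spaces. $\mathrm{Lin}(V,W)$ is the space of continuous linear maps between topological vector spaces and $\mathrm{Lin}\,V=\mathrm{Lin}(V,V)$. $\mathbb H$ and $\mathbb H_{\rm eff}$ are complex topological vector spaces, each with a complex conjugation $\varphi\mapsto\bar\varphi$ and a continuous symmetric bilinear form $\varphi^T\psi$ that is compatible with conjugation and definite in the sense that $\varphi^*\psi:=\bar\varphi^T\psi$ is a positive definite Hermitian inner product. $\mathbb H^*$ is the continuous dual, with pairing $\varphi^T\psi=\psi^T\varphi$ for $\varphi\in\mathbb H$, $\psi\in\mathbb H^*$; the bilinear form embeds $\mathbb H$ into $\mathbb H^*$ (same for $\mathbb H_{\rm eff}$). Operators. $A\in\mathrm{Lin}\,\mathbb H$ is symmetric if $(A\varphi)^T\psi=\varphi^TA\psi$ for all $\varphi,\psi\in\mathbb H$; it is then extended to $\mathbb H^*$ by $\varphi^TA\psi=(A\varphi)^T\psi$ for $\varphi\in\mathbb H,\psi\in\mathbb H^*$. $A^*=\bar A^T$ is the adjoint, $\mathrm{Im}\,A=\frac1{2i}(A-A^* )$, and $A$ is positive semidefinite if $\psi^*A\psi\ge0$ for all $\psi\in\mathbb H$. All products below are compositions of operators on the dual spaces. Embedding map. $P$ is an injective closed linear operator from $\mathbb H_{\rm eff}^*$ to $\mathbb H^*$ with $\bar P=P$ (it commutes with conjugation) and $P\psi_{\rm eff}\in\mathbb H$ for $\psi_{\rm eff}\in\mathbb H_{\rm eff}$. Its transpose $P^T=P^*$ maps $\mathbb H^*$ to $\mathbb H_{\rm eff}^*$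 and $\mathbb H$ to $\mathbb H_{\rm eff}$, with $(P^T\psi)^T\eta=\psi^TP\eta$ for $\psi\in\mathbb H^*,\eta\in\mathbb H_{\rm eff}$ and $(P^T\varphi)^T\chi=\varphi^TP\chi$ for $\varphi\in\mathbb H,\chi\in\mathbb H_{\rm eff}^*$. $P^TP$ is invertible on $\mathbb H_{\rm eff}^*$ and on $\mathbb H_{\rm eff}$. The pseudo inverse is $P^I:=(P^TP)^{-1}P^T$, and $Q:=1-PP^I$, so that $P^IP=1$, $P^TQ=P^IQ=0$, $QP=0$, $Q^2=Q^T=Q$. $Q$-resolvent. A $Q$-resolvent of a symmetric $L\in\mathrm{Lin}\,\mathbb H$ is a symmetric $G\in\mathrm{Lin}\,\mathbb H$ with $GP=0$ and $GLQ=Q$. *)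

theory Defs
  imports "HOL-Analysis.Analysis" "HOL-Library.Complex_Order"
begin

section \<open>Complex topological vector spaces with conjugation and bilinear form\<close>

class complex_vector = ab_group_add +
  fixes scaleC :: "complex \<Rightarrow> 'a \<Rightarrow> 'a"  (infixr "*\<^sub>C" 75)
  assumes scaleC_add_right: "a *\<^sub>C (x + y) = a *\<^sub>C x + a *\<^sub>C y"
    and scaleC_add_left: "(a + b) *\<^sub>C x = a *\<^sub>C x + b *\<^sub>C x"
    and scaleC_scaleC: "a *\<^sub>C b *\<^sub>C x = (a * b) *\<^sub>C x"
    and scaleC_one: "1 *\<^sub>C x = x"

class complex_conj_vector = complex_vector +
  fixes cconj :: "'a \<Rightarrow> 'a"
  assumes cconj_add: "cconj (x + y) = cconj x + cconj y"
    and cconj_scaleC: "cconj (a *\<^sub>C x) = cnj a *\<^sub>C cconj x"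
    and cconj_cconj: "cconj (cconj x) = x"

class complex_tvs = complex_vector + topological_ab_group_add +
  assumes tendsto_scaleC_Pair:
    "LIM x (nhds a \<times>\<^sub>F nhds b). fst x *\<^sub>C snd x :> nhds (a *\<^sub>C b)"

text \<open>
  The conjugation is taken to be continuous, so that the conjugate of a continuous functional is
  again continuous.  The form \<open>\<phi>\<^sup>T \<psi>\<close> is \<open>bform \<phi> \<psi>\<close>, and \<open>\<phi>\<^sup>* \<psi>\<close> is
  \<open>bform (cconj \<phi>) \<psi>\<close>; the order on \<^typ>\<open>complex\<close> makes \<open>0 < z\<close> include that \<open>z\<close> is real.
\<close>

class conj_tvs = complex_tvs + complex_conj_vector +
  fixes bform :: "'a \<Rightarrow> 'a \<Rightarrow> complex"
  assumes tendsto_cconj_nhds: "(cconj \<longlongrightarrow> cconj a) (nhds a)"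
    and bform_add_right: "bform x (y + z) = bform x y + bform x z"
    and bform_scaleC_right: "bform x (c *\<^sub>C y) = c * bform x y"
    and bform_commute: "bform x y = bform y x"
    and tendsto_bform_Pair:
      "LIM x (nhds a \<times>\<^sub>F nhds b). bform (fst x) (snd x) :> nhds (bform a b)"
    and bform_cconj: "bform (cconj x) (cconj y) = cnj (bform x y)"
    and bform_pos_def: "x \<noteq> 0 \<Longrightarrow> 0 < bform (cconj x) x"

lemma vector_space_scaleC: "vector_space (scaleC :: complex \<Rightarrow> 'a::complex_vector \<Rightarrow> 'a)"
  by unfold_locales (simp_all add: scaleC_add_right scaleC_add_left scaleC_scaleC scaleC_one)

interpretation cvec: vector_space "scaleC :: complex \<Rightarrow> 'a::complex_vector \<Rightarrow> 'a"
  by (rule vector_space_scaleC)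

abbreviation clinear :: "('a::complex_vector \<Rightarrow> 'b::complex_vector) \<Rightarrow> bool"
  where "clinear \<equiv> Vector_Spaces.linear scaleC scaleC"

lemma vector_space_complex: "vector_space ((*) :: complex \<Rightarrow> complex \<Rightarrow> complex)"
  by unfold_locales (simp_all add: algebra_simps)

lemma clinearI:
  assumes "\<And>x y. f (x + y) = f x + f y" "\<And>c x. f (c *\<^sub>C x) = c *\<^sub>C f x"
  shows "clinear f"
  using assms
  by (auto simp: Vector_Spaces.linear_def module_hom_def module_hom_axioms_def
      vector_space_scaleC cvec.module_axioms)

lemma clinear_functionalI:
  assumes "\<And>x y. f (x + y) = f x + f y" "\<And>c x. f (c *\<^sub>C x) = c * f x"
  shows "Vector_Spaces.linear scaleC (*) f"
  using assms vector_space_complex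
  by (auto simp: Vector_Spaces.linear_def module_hom_def module_hom_axioms_def
      vector_space_scaleC cvec.module_axioms module_iff_vector_space)

lemma clinear_add: "clinear f \<Longrightarrow> f (x + y) = f x + f y"
  by (auto simp: Vector_Spaces.linear_def module_hom_def module_hom_axioms_def)

lemma clinear_scaleC: "clinear f \<Longrightarrow> f (c *\<^sub>C x) = c *\<^sub>C f x"
  by (auto simp: Vector_Spaces.linear_def module_hom_def module_hom_axioms_def)

lemma clinear_functional_add: "Vector_Spaces.linear scaleC (*) f \<Longrightarrow> f (x + y) = f x + f y"
  by (auto simp: Vector_Spaces.linear_def module_hom_def module_hom_axioms_def)

lemma clinear_functional_scaleC: "Vector_Spaces.linear scaleC (*) f \<Longrightarrow> f (c *\<^sub>C x) = c * f x"
  by (auto simp: Vector_Spaces.linear_def module_hom_def module_hom_axioms_def)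

lemma continuous_on_UNIV_iff_tendsto: "continuous_on UNIV f \<longleftrightarrow> (\<forall>x. (f \<longlongrightarrow> f x) (nhds x))"
  by (simp add: continuous_on_def tendsto_at_iff_tendsto_nhds)

lemma tendsto_scaleC_const:
  fixes f :: "'b \<Rightarrow> 'a::complex_tvs"
  assumes "(f \<longlongrightarrow> y) F"
  shows "((\<lambda>x. c *\<^sub>C f x) \<longlongrightarrow> c *\<^sub>C y) F"
  using filterlim_compose[OF tendsto_scaleC_Pair filterlim_Pair[OF tendsto_const assms]]
  by simp

section \<open>The continuous dual\<close>

typedef (overloaded) 'a dual =
  "{f :: 'a::complex_tvs \<Rightarrow> complex. Vector_Spaces.linear scaleC (*) f \<and> continuous_on UNIV f}"
  morphisms pairing Abs_dual
  by (rule exI[of _ "\<lambda>_. 0"]) (auto intro: clinear_functionalI)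

setup_lifting type_definition_dual

lemma dual_eqI: "(\<And>\<phi>. pairing f \<phi> = pairing g \<phi>) \<Longrightarrow> f = g"
  by (metis ext pairing_inject)

lemma pairing_add_right: "pairing f (x + y) = pairing f x + pairing f y"
  using pairing[of f] by (auto intro: clinear_functional_add)

lemma pairing_scaleC_right: "pairing f (c *\<^sub>C x) = c * pairing f x"
  using pairing[of f] by (auto intro: clinear_functional_scaleC)

lemma tendsto_pairing: "(pairing f \<longlongrightarrow> pairing f x) (nhds x)"
  using pairing[of f] by (auto simp: continuous_on_UNIV_iff_tendsto)

instantiation dual :: (complex_tvs) complex_vector
begin

lift_definition zero_dual :: "'a dual" is "\<lambda>_. 0"
  by (auto intro: clinear_functionalI)

lift_definition plus_dual :: "'a dual \<Rightarrow> 'a dual \<Rightarrow> 'a dual" is "\<lambda>f g x. f x + g x"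
  by (auto intro!: clinear_functionalI continuous_intros
      simp: clinear_functional_add clinear_functional_scaleC algebra_simps)

lift_definition minus_dual :: "'a dual \<Rightarrow> 'a dual \<Rightarrow> 'a dual" is "\<lambda>f g x. f x - g x"
  by (auto intro!: clinear_functionalI continuous_intros
      simp: clinear_functional_add clinear_functional_scaleC algebra_simps)

lift_definition uminus_dual :: "'a dual \<Rightarrow> 'a dual" is "\<lambda>f x. - f x"
  by (auto intro!: clinear_functionalI continuous_intros
      simp: clinear_functional_add clinear_functional_scaleC algebra_simps)

lift_definition scaleC_dual :: "complex \<Rightarrow> 'a dual \<Rightarrow> 'a dual" is "\<lambda>c f x. c * f x"
  by (auto intro!: clinear_functionalI continuous_intros
      simp: clinear_functional_add clinear_functional_scaleC algebra_simps)

instance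
  by (standard; rule dual_eqI)
    (simp_all add: zero_dual.rep_eq plus_dual.rep_eq minus_dual.rep_eq uminus_dual.rep_eq
      scaleC_dual.rep_eq algebra_simps)

end

lemmas pairing_simps =
  zero_dual.rep_eq plus_dual.rep_eq minus_dual.rep_eq uminus_dual.rep_eq scaleC_dual.rep_eq
  pairing_add_right pairing_scaleC_right

instantiation dual :: (conj_tvs) complex_conj_vector
begin

lift_definition cconj_dual :: "'a dual \<Rightarrow> 'a dual" is "\<lambda>f \<phi>. cnj (f (cconj \<phi>))"
proof -
  fix f :: "'a \<Rightarrow> complex"
  assume f: "Vector_Spaces.linear scaleC (*) f \<and> continuous_on UNIV f"
  have "((\<lambda>\<phi>. cnj (f (cconj \<phi>))) \<longlongrightarrow> cnj (f (cconj x))) (nhds x)" for x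
    using f tendsto_cconj_nhds[of x]
    by (auto simp: continuous_on_UNIV_iff_tendsto intro!: tendsto_cnj intro: filterlim_compose)
  then show "Vector_Spaces.linear scaleC (*) (\<lambda>\<phi>. cnj (f (cconj \<phi>))) \<and>
      continuous_on UNIV (\<lambda>\<phi>. cnj (f (cconj \<phi>)))"
    using f
    by (auto intro!: clinear_functionalI simp: continuous_on_UNIV_iff_tendsto cconj_add
        cconj_scaleC clinear_functional_add clinear_functional_scaleC)
qed

instance
  by (standard; rule dual_eqI)
    (simp_all add: cconj_dual.rep_eq plus_dual.rep_eq scaleC_dual.rep_eq cconj_cconj)

end

text \<open>The dual carries the weak-* topology, i.e. that of pointwise convergence.\<close>

instantiation dual :: (complex_tvs) topological_space
begin

definition open_dual :: "'a dual set \<Rightarrow> bool"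
  where "open_dual U \<longleftrightarrow> (\<exists>V. open V \<and> U = pairing -` V)"

instance
proof
  show "open (UNIV :: 'a dual set)"
    unfolding open_dual_def by (rule exI[of _ UNIV]) auto
  fix S T :: "'a dual set"
  assume "open S" "open T"
  then show "open (S \<inter> T)"
    unfolding open_dual_def by (metis open_Int vimage_Int)
next
  fix K :: "'a dual set set"
  assume "\<forall>S\<in>K. open S"
  then obtain V where V: "\<And>S. S \<in> K \<Longrightarrow> open (V S) \<and> S = pairing -` V S"
    unfolding open_dual_def by metis
  have "\<Union>K = pairing -` (\<Union>S\<in>K. V S)"
    using V by blast
  moreover have "open (\<Union>S\<in>K. V S)"
    using V by auto
  ultimately show "open (\<Union>K)"
    unfolding open_dual_def by blast
qed

end

lemma continuous_on_pairing_left: "continuous_on UNIV (\<lambda>\<xi>. pairing \<xi> \<phi>)"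
proof -
  have "continuous_on UNIV (pairing :: 'a dual \<Rightarrow> _)"
    unfolding continuous_on_open_vimage[OF open_UNIV] open_dual_def by auto
  then show ?thesis
    by (rule continuous_on_product_then_coordinatewise)
qed

lift_definition emb :: "'a::conj_tvs \<Rightarrow> 'a dual" is "\<lambda>\<phi> \<psi>. bform \<phi> \<psi>"
proof -
  fix \<phi> :: 'a
  have "((\<lambda>\<psi>. bform \<phi> \<psi>) \<longlongrightarrow> bform \<phi> x) (nhds x)" for x
    using filterlim_compose[OF tendsto_bform_Pair
        filterlim_Pair[OF tendsto_const[of \<phi>] filterlim_ident[of "nhds x"]]]
    by simp
  then show "Vector_Spaces.linear scaleC (*) (bform \<phi>) \<and> continuous_on UNIV (bform \<phi>)"
    by (auto intro!: clinear_functionalI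
        simp: continuous_on_UNIV_iff_tendsto bform_add_right bform_scaleC_right)
qed

lemma bform_diff_right: "bform (x::'a::conj_tvs) (y - z) = bform x y - bform x z"
  by (metis add_diff_cancel_right' bform_add_right diff_add_cancel)

lemma inj_emb: "inj emb"
proof (rule injI)
  fix x y :: "'a::conj_tvs"
  assume "emb x = emb y"
  then have "bform x z = bform y z" for z
    by (metis emb.rep_eq)
  then have "bform z x = bform z y" for z
    by (metis bform_commute)
  then have "bform (cconj (x - y)) (x - y) = 0"
    by (simp add: bform_diff_right)
  then show "x = y"
    using bform_pos_def[of "x - y"] by auto
qed

lemma cconj_emb: "cconj (emb \<phi>) = emb (cconj \<phi>)"
proof (rule dual_eqI)
  fix \<eta>
  show "pairing (cconj (emb \<phi>)) \<eta> = pairing (emb (cconj \<phi>)) \<eta>"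
    using bform_cconj[of \<phi> "cconj \<eta>"]
    by (simp add: emb.rep_eq cconj_dual.rep_eq cconj_cconj)
qed

lemma pairing_separates:
  assumes "\<And>\<xi>. pairing \<xi> x = pairing \<xi> y"
  shows "x = (y::'a::conj_tvs)"
proof -
  have "emb x = emb y"
    by (rule dual_eqI) (metis assms bform_commute emb.rep_eq)
  then show ?thesis
    by (rule injD[OF inj_emb])
qed

section \<open>Operators\<close>

definition Lin :: "('a::complex_tvs \<Rightarrow> 'b::complex_tvs) set"
  where "Lin = {A. clinear A \<and> continuous_on UNIV A}"

definition symmetric_op :: "('a::conj_tvs \<Rightarrow> 'a) \<Rightarrow> bool"
  where "symmetric_op A \<longleftrightarrow> (\<forall>\<phi> \<psi>. bform (A \<phi>) \<psi> = bform \<phi> (A \<psi>))"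

text \<open>Extension of a symmetric \<open>A \<in> Lin\<close> to the dual.\<close>

definition ext_dual :: "('a::conj_tvs \<Rightarrow> 'a) \<Rightarrow> 'a dual \<Rightarrow> 'a dual"
  where "ext_dual A \<psi> = Abs_dual (\<lambda>\<phi>. pairing \<psi> (A \<phi>))"

lemma pairing_ext_dual:
  assumes "A \<in> Lin"
  shows "pairing (ext_dual A \<psi>) \<phi> = pairing \<psi> (A \<phi>)"
proof -
  have "Vector_Spaces.linear scaleC (*) (\<lambda>\<phi>. pairing \<psi> (A \<phi>))"
    using assms unfolding Lin_def
    by (auto intro!: clinear_functionalI simp: clinear_add clinear_scaleC pairing_simps)
  moreover have "((\<lambda>\<phi>. pairing \<psi> (A \<phi>)) \<longlongrightarrow> pairing \<psi> (A x)) (nhds x)" for x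
    using assms unfolding Lin_def
    by (auto simp: continuous_on_UNIV_iff_tendsto intro!: filterlim_compose[OF tendsto_pairing])
  ultimately show ?thesis
    unfolding ext_dual_def
    by (subst Abs_dual_inverse) (auto simp: continuous_on_UNIV_iff_tendsto)
qed

lemma ext_dual_emb:
  assumes "A \<in> Lin" "symmetric_op A"
  shows "ext_dual A (emb \<phi>) = emb (A \<phi>)"
  using assms(2) by (intro dual_eqI) (simp add: pairing_ext_dual[OF assms(1)] emb.rep_eq symmetric_op_def)

text \<open>
  The transpose on the space itself is unique when it exists (the form is nondegenerate); it exists
  in particular for symmetric operators, the only ones whose adjoint is needed below.
\<close>

definition op_transpose :: "('a::conj_tvs \<Rightarrow> 'a) \<Rightarrow> 'a \<Rightarrow> 'a"
  where "op_transpose A = (THE B. \<forall>\<phi> \<psi>. bform (B \<phi>) \<psi> = bform \<phi> (A \<psi>))"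

definition op_cconj :: "('a::complex_conj_vector \<Rightarrow> 'b::complex_conj_vector) \<Rightarrow> 'a \<Rightarrow> 'b"
  where "op_cconj A = (\<lambda>\<phi>. cconj (A (cconj \<phi>)))"

definition op_adjoint :: "('a::conj_tvs \<Rightarrow> 'a) \<Rightarrow> 'a \<Rightarrow> 'a"
  where "op_adjoint A = op_transpose (op_cconj A)"

definition op_Im :: "('a::conj_tvs \<Rightarrow> 'a) \<Rightarrow> 'a \<Rightarrow> 'a"
  where "op_Im A = (\<lambda>\<phi>. (1 / (2 * \<i>)) *\<^sub>C (A \<phi> - op_adjoint A \<phi>))"

definition pos_semidef :: "('a::conj_tvs \<Rightarrow> 'a) \<Rightarrow> bool"
  where "pos_semidef A \<longleftrightarrow> (\<forall>\<psi>. 0 \<le> bform (cconj \<psi>) (A \<psi>))"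

lemma op_transpose_eqI:
  assumes "\<And>\<phi> \<psi>. bform (B \<phi>) \<psi> = bform \<phi> (A \<psi>)"
  shows "op_transpose A = B"
  unfolding op_transpose_def
proof (rule the_equality)
  fix C
  assume C: "\<forall>\<phi> \<psi>. bform (C \<phi>) \<psi> = bform \<phi> (A \<psi>)"
  have "emb (C \<phi>) = emb (B \<phi>)" for \<phi>
    by (rule dual_eqI) (simp add: emb.rep_eq C assms)
  then show "C = B"
    by (intro ext injD[OF inj_emb])
qed (use assms in simp)

lemma op_adjoint_symmetric:
  assumes "symmetric_op A"
  shows "bform (cconj (op_adjoint A \<phi>)) \<psi> = bform (cconj \<phi>) (A \<psi>)"
proof -
  have "bform (op_cconj A x) y = bform x (op_cconj A y)" for x y
  proof -
    have "bform (op_cconj A x) y = cnj (bform (A (cconj x)) (cconj y))"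
      unfolding op_cconj_def by (metis bform_cconj cconj_cconj)
    also have "\<dots> = cnj (bform (cconj x) (A (cconj y)))"
      using assms by (simp add: symmetric_op_def)
    also have "\<dots> = bform x (op_cconj A y)"
      unfolding op_cconj_def by (metis bform_cconj cconj_cconj)
    finally show ?thesis .
  qed
  then have "op_adjoint A = op_cconj A"
    unfolding op_adjoint_def by (rule op_transpose_eqI)
  then show ?thesis
    using assms by (simp add: op_cconj_def cconj_cconj symmetric_op_def)
qed

section \<open>Embedding maps, pseudo inverses, and Q-resolvents\<close>

text \<open>
  The restriction of \<open>P\<close> to a map between the spaces themselves, for \<open>P\<close> mapping \<open>range emb\<close> into
  \<open>range emb\<close>.
\<close>

definition restr :: "('e::conj_tvs dual \<Rightarrow> 'h::conj_tvs dual) \<Rightarrow> 'e \<Rightarrow> 'h"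
  where "restr P \<eta> = inv emb (P (emb \<eta>))"

text \<open>The transpose of \<open>P\<close>, on the dual and on the space; unique whenever it exists.\<close>

definition is_transpose_dual ::
    "('e::conj_tvs dual \<Rightarrow> 'h::conj_tvs dual) \<Rightarrow> ('h dual \<Rightarrow> 'e dual) \<Rightarrow> bool"
  where "is_transpose_dual P T \<longleftrightarrow> (\<forall>\<psi> \<eta>. pairing (T \<psi>) \<eta> = pairing \<psi> (restr P \<eta>))"

definition is_transpose_space ::
    "('e::conj_tvs dual \<Rightarrow> 'h::conj_tvs dual) \<Rightarrow> ('h \<Rightarrow> 'e) \<Rightarrow> bool"
  where "is_transpose_space P T \<longleftrightarrow> (\<forall>\<phi> \<xi>. pairing \<xi> (T \<phi>) = pairing (P \<xi>) \<phi>)"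

definition transpose_dual :: "('e::conj_tvs dual \<Rightarrow> 'h::conj_tvs dual) \<Rightarrow> 'h dual \<Rightarrow> 'e dual"
  where "transpose_dual P = (THE T. is_transpose_dual P T)"

definition transpose_space :: "('e::conj_tvs dual \<Rightarrow> 'h::conj_tvs dual) \<Rightarrow> 'h \<Rightarrow> 'e"
  where "transpose_space P = (THE T. is_transpose_space P T)"

lemma transpose_dual_eqI:
  assumes "is_transpose_dual P T"
  shows "transpose_dual P = T"
  unfolding transpose_dual_def
proof (rule the_equality)
  fix S
  assume "is_transpose_dual P S"
  then have "S \<psi> = T \<psi>" for \<psi>
    using assms by (intro dual_eqI) (simp add: is_transpose_dual_def)
  then show "S = T" ..
qed (rule assms)

lemma transpose_space_eqI:
  assumes "is_transpose_space P T"
  shows "transpose_space P = T"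
  unfolding transpose_space_def
proof (rule the_equality)
  fix S
  assume "is_transpose_space P S"
  then have "S \<phi> = T \<phi>" for \<phi>
    using assms by (intro pairing_separates) (simp add: is_transpose_space_def)
  then show "S = T" ..
qed (rule assms)

text \<open>
  \<open>P\<close> is closed in the sense that its graph is closed.  Given the transpose on the space, this holds
  automatically (see \<open>closed_graph_transpose\<close> below), hence also for any finer topologies on the
  duals.
\<close>

definition eff_embedding :: "('e::conj_tvs dual \<Rightarrow> 'h::conj_tvs dual) \<Rightarrow> bool"
  where "eff_embedding P \<longleftrightarrow>
    clinear P \<and> inj P \<and> closed {(\<xi>, P \<xi>) | \<xi>. True} \<and>
    op_cconj P = P \<and>
    (\<forall>\<eta>. P (emb \<eta>) \<in> range emb) \<and>
    (\<exists>T. is_transpose_dual P T) \<and> (\<exists>T. is_transpose_space P T) \<and>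
    bij (transpose_dual P \<circ> P) \<and> bij (transpose_space P \<circ> restr P)"

lemma closed_graph_transpose:
  assumes "is_transpose_space P T"
  shows "closed {(\<xi>, P \<xi>) | \<xi>. True}"
proof -
  have "{(\<xi>, P \<xi>) | \<xi>. True} = (\<Inter>\<phi>. {z. pairing (snd z) \<phi> = pairing (fst z) (T \<phi>)})"
    using assms by (auto simp: is_transpose_space_def intro!: dual_eqI)
  moreover have "closed {z. pairing (snd z) \<phi> = pairing (fst z) (T \<phi>)}" for \<phi>
    by (intro closed_Collect_eq continuous_on_compose2[OF continuous_on_pairing_left]
        continuous_intros) auto
  ultimately show ?thesis
    by (auto intro: closed_INT)
qed

definition pseudo_inverse :: "('e::conj_tvs dual \<Rightarrow> 'h::conj_tvs dual) \<Rightarrow> 'h dual \<Rightarrow> 'e dual"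
  where "pseudo_inverse P = inv (transpose_dual P \<circ> P) \<circ> transpose_dual P"

definition Q_of :: "('e::conj_tvs dual \<Rightarrow> 'h::conj_tvs dual) \<Rightarrow> 'h dual \<Rightarrow> 'h dual"
  where "Q_of P = (\<lambda>\<psi>. \<psi> - P (pseudo_inverse P \<psi>))"

definition Q_resolvent ::
    "('e::conj_tvs dual \<Rightarrow> 'h::conj_tvs dual) \<Rightarrow> ('h \<Rightarrow> 'h) \<Rightarrow> ('h \<Rightarrow> 'h) \<Rightarrow> bool"
  where "Q_resolvent P L G \<longleftrightarrow>
    G \<in> Lin \<and> symmetric_op G \<and>
    ext_dual G \<circ> P = (\<lambda>_. 0) \<and>
    ext_dual G \<circ> ext_dual L \<circ> Q_of P = Q_of P"

definition L_eff ::
    "('e::conj_tvs dual \<Rightarrow> 'h::conj_tvs dual) \<Rightarrow> ('h \<Rightarrow> 'h) \<Rightarrow> ('h \<Rightarrow> 'h) \<Rightarrow> 'e dual \<Rightarrow> 'e dual"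
  where "L_eff P L G = (\<lambda>\<xi>.
    transpose_dual P (ext_dual L (P \<xi>)) -
    transpose_dual P (ext_dual L (ext_dual G (ext_dual L (P \<xi>)))))"

end

theory Submission
  imports Defs
begin

text \<open>
  Both parts rest on the splitting \<open>\<psi> = P P\<^sup>I \<psi> + Q \<psi>\<close>. For part (ii), applying \<open>G L\<close> to this splitting
  and using \<open>G L Q = Q\<close> gives \<open>0 = G L P \<psi>\<^sub>e + Q \<psi>\<close>, which is the reconstruction formula; then
  \<open>L\<^sub>e \<psi>\<^sub>e = P\<^sup>T L \<psi> = 0\<close>. For part (i), \<open>L\<^sub>e \<psi>\<^sub>e = P\<^sup>T L \<psi> = 0\<close> says \<open>L \<psi> = Q L \<psi>\<close>, and the transposed
  resolvent identity \<open>Q L G = Q\<close> yields \<open>Q L \<psi> = Q L P \<psi>\<^sub>e - Q L G L P \<psi>\<^sub>e = 0\<close>; moreover \<open>P\<^sup>I G = 0\<close> is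
  the transpose of \<open>G P = 0\<close>. Transposing identities on the dual requires descending to the space,
  where \<open>Q\<close> restricts to \<open>1 - P (P\<^sup>T P)\<^sup>-\<^sup>1 P\<^sup>T\<close>.
\<close>

lemma ext_dual_diff:
  assumes "A \<in> Lin"
  shows "ext_dual A (x - y) = ext_dual A x - ext_dual A y"
  by (rule dual_eqI) (simp add: pairing_ext_dual[OF assms] pairing_simps)

lemma ext_dual_zero:
  assumes "A \<in> Lin"
  shows "ext_dual A 0 = 0"
  using ext_dual_diff[OF assms, of 0 0] by simp

lemma pairing_diff_right: "pairing f (x - y) = pairing f x - pairing f y"
  by (metis add_diff_cancel_right' diff_add_cancel pairing_add_right)

lemma emb_diff: "emb (x - y) = emb x - emb y"
  by (rule dual_eqI) (metis bform_commute bform_diff_right emb.rep_eq minus_dual.rep_eq)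

lemma pairing_emb_commute: "pairing (emb x) y = pairing (emb y) x"
  by (simp add: emb.rep_eq bform_commute)

context
  fixes P :: "'e::conj_tvs dual \<Rightarrow> 'h::conj_tvs dual"
  assumes P: "eff_embedding P"
begin

lemma embedding_diff: "P (x - y) = P x - P y"
proof -
  have "clinear P"
    using P by (simp add: eff_embedding_def)
  then show ?thesis
    by (metis add_diff_cancel_right' clinear_add diff_add_cancel)
qed

lemma embedding_zero: "P 0 = 0"
  using embedding_diff[of 0 0] by simp

lemma emb_restr: "emb (restr P \<eta>) = P (emb \<eta>)"
  using P by (simp add: eff_embedding_def restr_def f_inv_into_f)

lemma pairing_transpose_dual: "pairing (transpose_dual P \<psi>) \<eta> = pairing \<psi> (restr P \<eta>)"
proof -
  obtain T where "is_transpose_dual P T"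
    using P by (auto simp: eff_embedding_def)
  then show ?thesis
    using transpose_dual_eqI[of P T] by (simp add: is_transpose_dual_def)
qed

lemma pairing_transpose_space: "pairing \<xi> (transpose_space P \<phi>) = pairing (P \<xi>) \<phi>"
proof -
  obtain T where "is_transpose_space P T"
    using P by (auto simp: eff_embedding_def)
  then show ?thesis
    using transpose_space_eqI[of P T] by (simp add: is_transpose_space_def)
qed

lemma transpose_dual_diff:
  "transpose_dual P (x - y) = transpose_dual P x - transpose_dual P y"
  by (rule dual_eqI) (simp add: pairing_transpose_dual pairing_simps)

lemma transpose_dual_zero: "transpose_dual P 0 = 0"
  using transpose_dual_diff[of 0 0] by simp

text \<open>Symmetry of the two forms lets \<phi> and the test vector swap roles, so both transposes
  reduce to the pairing of \<open>P (emb \<eta>)\<close> with \<phi>.\<close>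

lemma transpose_dual_emb: "transpose_dual P (emb \<phi>) = emb (transpose_space P \<phi>)"
proof (rule dual_eqI)
  fix \<eta>
  have "pairing (transpose_dual P (emb \<phi>)) \<eta> = pairing (P (emb \<eta>)) \<phi>"
    by (metis pairing_transpose_dual pairing_emb_commute emb_restr)
  also have "\<dots> = pairing (emb (transpose_space P \<phi>)) \<eta>"
    by (metis pairing_transpose_space pairing_emb_commute)
  finally show "pairing (transpose_dual P (emb \<phi>)) \<eta> = pairing (emb (transpose_space P \<phi>)) \<eta>" .
qed

text \<open>Injectivity of \<open>P\<^sup>T P\<close> makes the normal equation characterize
  \<open>P\<^sup>I \<psi>\<close>; later values of the pseudo inverse are found by solving
  it.\<close>

lemma pseudo_inverse_eqI:
  assumes "transpose_dual P (P \<xi>) = transpose_dual P \<psi>"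
  shows "pseudo_inverse P \<psi> = \<xi>"
proof -
  have "inj (transpose_dual P \<circ> P)"
    using P by (simp add: eff_embedding_def bij_is_inj)
  then show ?thesis
    using assms by (simp add: pseudo_inverse_def inv_f_eq)
qed

lemma transpose_dual_pseudo_inverse:
  "transpose_dual P (P (pseudo_inverse P \<psi>)) = transpose_dual P \<psi>"
proof -
  have "bij (transpose_dual P \<circ> P)"
    using P by (simp only: eff_embedding_def)
  then have "surj (transpose_dual P \<circ> P)"
    by (rule bij_is_surj)
  then show ?thesis
    using surj_f_inv_f[of "transpose_dual P \<circ> P" "transpose_dual P \<psi>"]
    by (simp add: pseudo_inverse_def)
qed

definition Q_space :: "'h \<Rightarrow> 'h"
  where "Q_space \<phi> =
    \<phi> - restr P (inv (transpose_space P \<circ> restr P) (transpose_space P \<phi>))"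

lemma transpose_space_restr_inv:
  "transpose_space P (restr P (inv (transpose_space P \<circ> restr P) (transpose_space P \<phi>))) =
    transpose_space P \<phi>"
proof -
  have "bij (transpose_space P \<circ> restr P)"
    using P by (simp only: eff_embedding_def)
  then have "surj (transpose_space P \<circ> restr P)"
    by (rule bij_is_surj)
  then show ?thesis
    using surj_f_inv_f[of "transpose_space P \<circ> restr P" "transpose_space P \<phi>"] by simp
qed

lemma Q_of_emb: "Q_of P (emb \<phi>) = emb (Q_space \<phi>)"
proof -
  let ?\<eta> = "inv (transpose_space P \<circ> restr P) (transpose_space P \<phi>)"
  have "transpose_dual P (P (emb ?\<eta>)) = transpose_dual P (emb \<phi>)"
    by (simp add: emb_restr[symmetric] transpose_dual_emb transpose_space_restr_inv)
  then have "pseudo_inverse P (emb \<phi>) = emb ?\<eta>"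
    by (rule pseudo_inverse_eqI)
  then show ?thesis
    by (simp add: Q_of_def Q_space_def emb_diff emb_restr)
qed

text \<open>This is \<open>Q\<^sup>T = Q\<close>: both correction terms equal the pairing of
  \<open>P ?\<xi>\<close> with \<open>restr P ?\<eta>\<close>.\<close>

lemma pairing_Q_of: "pairing (Q_of P \<psi>) \<phi> = pairing \<psi> (Q_space \<phi>)"
proof -
  let ?\<eta> = "inv (transpose_space P \<circ> restr P) (transpose_space P \<phi>)"
  let ?\<xi> = "pseudo_inverse P \<psi>"
  \<comment> \<open>Vectors in the range of \<open>P\<close> see \<phi> only through
    \<open>P\<^sup>T \<phi>\<close>, which \<phi> shares with
    \<open>restr P ?\<eta>\<close>.\<close>
  have "pairing (P ?\<xi>) \<phi> = pairing (P ?\<xi>) (restr P ?\<eta>)"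
    by (metis pairing_transpose_space transpose_space_restr_inv)
  also have "\<dots> = pairing \<psi> (restr P ?\<eta>)"
    by (metis pairing_transpose_dual transpose_dual_pseudo_inverse)
  finally show ?thesis
    by (simp add: Q_of_def Q_space_def pairing_diff_right minus_dual.rep_eq)
qed

lemma Q_of_diff: "Q_of P (x - y) = Q_of P x - Q_of P y"
  by (rule dual_eqI) (simp add: pairing_Q_of pairing_simps)

lemma Q_of_fixed:
  assumes "transpose_dual P \<psi> = 0"
  shows "Q_of P \<psi> = \<psi>"
proof -
  have "pseudo_inverse P \<psi> = 0"
    by (rule pseudo_inverse_eqI) (simp add: assms embedding_zero transpose_dual_zero)
  then show ?thesis
    by (simp add: Q_of_def embedding_zero)
qed

context
  fixes L G :: "'h \<Rightarrow> 'h"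
  assumes L: "L \<in> Lin" "symmetric_op L" and G: "Q_resolvent P L G"
begin

lemma resolvent_Lin: "G \<in> Lin" "symmetric_op G"
  using G by (auto simp: Q_resolvent_def)

lemma transpose_dual_resolvent: "transpose_dual P (ext_dual G \<psi>) = 0"
proof (rule dual_eqI)
  fix \<eta>
  \<comment> \<open>The identity \<open>G P = 0\<close> on the dual descends to the space by
    injectivity of \<open>emb\<close>; there it can be paired with an arbitrary \<psi>.\<close>
  have "emb (G (restr P \<eta>)) = ext_dual G (P (emb \<eta>))"
    by (metis ext_dual_emb[OF resolvent_Lin] emb_restr)
  also have "\<dots> = emb 0"
    using G emb_diff[of 0 0] by (simp add: Q_resolvent_def fun_eq_iff)
  finally have "G (restr P \<eta>) = 0"
    by (rule injD[OF inj_emb])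
  then show "pairing (transpose_dual P (ext_dual G \<psi>)) \<eta> = pairing 0 \<eta>"
    using pairing_diff_right[of \<psi> 0 0]
    by (simp add: pairing_transpose_dual pairing_ext_dual[OF resolvent_Lin(1)] zero_dual.rep_eq)
qed

text \<open>Moving the operators onto the test vector one by one reverses their order, so the claim
  becomes \<open>G L Q = Q\<close> on the space.\<close>

lemma Q_of_L_resolvent: "Q_of P (ext_dual L (ext_dual G \<psi>)) = Q_of P \<psi>"
proof (rule dual_eqI)
  fix \<phi>
  have "emb (G (L (Q_space \<phi>))) = ext_dual G (ext_dual L (Q_of P (emb \<phi>)))"
    by (simp add: ext_dual_emb[OF resolvent_Lin] ext_dual_emb[OF L] Q_of_emb)
  also have "\<dots> = emb (Q_space \<phi>)"
    using G by (simp add: Q_resolvent_def fun_eq_iff flip: Q_of_emb)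
  finally have "G (L (Q_space \<phi>)) = Q_space \<phi>"
    by (rule injD[OF inj_emb])
  then show "pairing (Q_of P (ext_dual L (ext_dual G \<psi>))) \<phi> = pairing (Q_of P \<psi>) \<phi>"
    by (simp add: pairing_Q_of pairing_ext_dual[OF L(1)] pairing_ext_dual[OF resolvent_Lin(1)])
qed

lemma L_eff_eq:
  "L_eff P L G \<xi> = transpose_dual P (ext_dual L (P \<xi> - ext_dual G (ext_dual L (P \<xi>))))"
  by (simp add: L_eff_def ext_dual_diff[OF L(1)] transpose_dual_diff)

lemma kernel_lift:
  assumes "L_eff P L G \<xi> = 0"
  shows "ext_dual L (P \<xi> - ext_dual G (ext_dual L (P \<xi>))) = 0"
proof -
  let ?\<psi> = "P \<xi> - ext_dual G (ext_dual L (P \<xi>))"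
  have "ext_dual L ?\<psi> = Q_of P (ext_dual L ?\<psi>)"
    using assms by (simp add: L_eff_eq Q_of_fixed)
  \<comment> \<open>\<open>Q L G = Q\<close>, applied to \<open>L P \<xi>\<close>, makes the two
    terms cancel.\<close>
  also have "\<dots> = 0"
    by (simp add: ext_dual_diff[OF L(1)] Q_of_diff Q_of_L_resolvent)
  finally show ?thesis .
qed

text \<open>Since \<open>P\<^sup>T G = 0\<close>, subtracting any vector in the range of
  \<open>G\<close> leaves the normal equation for \<xi> unchanged.\<close>

lemma pseudo_inverse_lift:
  "pseudo_inverse P (P \<xi> - ext_dual G \<psi>) = \<xi>"
  by (rule pseudo_inverse_eqI) (simp add: transpose_dual_diff transpose_dual_resolvent)

lemma kernel_reconstruct:
  assumes "ext_dual L \<psi> = 0"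
  shows "P (pseudo_inverse P \<psi>) - ext_dual G (ext_dual L (P (pseudo_inverse P \<psi>))) = \<psi>"
proof -
  have "ext_dual G (ext_dual L (Q_of P \<psi>)) = Q_of P \<psi>"
    using G by (simp add: Q_resolvent_def fun_eq_iff)
  moreover have P_inv: "P (pseudo_inverse P \<psi>) = \<psi> - Q_of P \<psi>"
    by (simp add: Q_of_def)
  \<comment> \<open>As \<open>L \<psi> = 0\<close>, only the term \<open>- G L Q \<psi>\<close>
    survives.\<close>
  ultimately have "ext_dual G (ext_dual L (P (pseudo_inverse P \<psi>))) = - Q_of P \<psi>"
    using assms ext_dual_zero[OF resolvent_Lin(1)]
    by (simp only: ext_dual_diff[OF L(1)] ext_dual_diff[OF resolvent_Lin(1)]) simp
  then show ?thesis
    by (simp add: P_inv)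
qed

end

end

theorem theorem3p3:
  fixes L G :: "'h::conj_tvs \<Rightarrow> 'h"
    and P :: "'e::conj_tvs dual \<Rightarrow> 'h dual"
  assumes "L \<in> Lin" and "symmetric_op L" and "pos_semidef (op_Im L)"
    and "eff_embedding P"
    and "Q_resolvent P L G"
  shows "(\<forall>\<psi>\<^sub>e. L_eff P L G \<psi>\<^sub>e = 0 \<longrightarrow>
            (let \<psi> = P \<psi>\<^sub>e - ext_dual G (ext_dual L (P \<psi>\<^sub>e))
             in ext_dual L \<psi> = 0 \<and> \<psi>\<^sub>e = pseudo_inverse P \<psi>)) \<and>
         (\<forall>\<psi>. ext_dual L \<psi> = 0 \<longrightarrow>
            (let \<psi>\<^sub>e = pseudo_inverse P \<psi>
             in L_eff P L G \<psi>\<^sub>e = 0 \<and>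
                \<psi> = P \<psi>\<^sub>e - ext_dual G (ext_dual L (P \<psi>\<^sub>e))))"
  \<comment> \<open>For the effective equation in (ii), reconstruction turns the factored form in
    \<open>L_eff_eq\<close> into \<open>P\<^sup>T L \<psi>\<close>, hence
    \<open>P\<^sup>T 0\<close>.\<close>
  using kernel_lift[OF assms(4,1,2,5)] pseudo_inverse_lift[OF assms(4,1,2,5)]
    kernel_reconstruct[OF assms(4,1,2,5)] L_eff_eq[OF assms(4,1,2,5)]
    transpose_dual_zero[OF assms(4)]
  by (simp add: Let_def)

end
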